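(* Let $T_0\subset\mathbb R^2$ be the triangle with vertices $(0,0)$, $(0,2)$ and $(2,0)$. For every point $(x,y)$ in the interior of $T_0$, the dual unit ball at $(x,y)$ for the Hilbert metric of (the interior of) $T_0$ has Euclidean area \[ A_{T_0}(x,y)=\frac{3}{2xy(2-x-y)}. \]
   Context: Let $\Omega\subset\mathbb R^2$ be a bounded open convex set. For $p\in\Omega$ and $0\ne\xi\in\mathbb R^2$, let $v^+,v^-\in\partial\Omega$ be the forward and backward intersection points with $\partial\Omega$ of the line through $p$ directed by $\xi$, and write $\xi=\sigma^+(v^+-p)=\sigma^-(p-v^-)$ with $\sigma^{\pm}>0$. The Hilbert Finsler norm is $\|\xi\|_{\Omega,p}=\frac12(\sigma^++\sigma^-)$. The unit ball is $B_p=\{\xi\in\mathbb R^2:\|\xi\|_{\Omega,p}\le1\}$ and the dual unit ball is $B_p^*=\{\eta\in\mathbb R^2:\langle\eta,\xi\rangle\le1\ \forall\xi\in B_p\}$, with $\langle\cdot,\cdot\rangle$ the standard inner product. *)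

theory Defs
  imports "HOL-Analysis.Analysis"
begin

text \<open>
  The definitions below are meant for a bounded open convex set \<open>\<Omega>\<close>, a point \<open>p \<in> \<Omega>\<close>
  and, up to the norm, a vector \<open>\<xi> \<noteq> 0\<close>. In that case the ray from \<open>p\<close> in direction \<open>\<xi>\<close>
  (respectively \<open>-\<xi>\<close>) meets the frontier of \<open>\<Omega>\<close> in exactly one point, so that all the
  definite descriptions are well defined.
\<close>

definition forward_point :: "(real^2) set \<Rightarrow> real^2 \<Rightarrow> real^2 \<Rightarrow> real^2" where
  "forward_point \<Omega> p \<xi> = (THE v. v \<in> frontier \<Omega> \<and> (\<exists>t>0. v = p + t *\<^sub>R \<xi>))"

definition backward_point :: "(real^2) set \<Rightarrow> real^2 \<Rightarrow> real^2 \<Rightarrow> real^2" where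
  "backward_point \<Omega> p \<xi> = (THE v. v \<in> frontier \<Omega> \<and> (\<exists>t>0. v = p - t *\<^sub>R \<xi>))"

definition sigma_plus :: "(real^2) set \<Rightarrow> real^2 \<Rightarrow> real^2 \<Rightarrow> real" where
  "sigma_plus \<Omega> p \<xi> = (THE s. s > 0 \<and> \<xi> = s *\<^sub>R (forward_point \<Omega> p \<xi> - p))"

definition sigma_minus :: "(real^2) set \<Rightarrow> real^2 \<Rightarrow> real^2 \<Rightarrow> real" where
  "sigma_minus \<Omega> p \<xi> = (THE s. s > 0 \<and> \<xi> = s *\<^sub>R (p - backward_point \<Omega> p \<xi>))"

definition hilbert_norm :: "(real^2) set \<Rightarrow> real^2 \<Rightarrow> real^2 \<Rightarrow> real" where
  "hilbert_norm \<Omega> p \<xi> =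
     (if \<xi> = 0 then 0 else (sigma_plus \<Omega> p \<xi> + sigma_minus \<Omega> p \<xi>) / 2)"

definition hilbert_ball :: "(real^2) set \<Rightarrow> real^2 \<Rightarrow> (real^2) set" where
  "hilbert_ball \<Omega> p = {\<xi>. hilbert_norm \<Omega> p \<xi> \<le> 1}"

definition dual_hilbert_ball :: "(real^2) set \<Rightarrow> real^2 \<Rightarrow> (real^2) set" where
  "dual_hilbert_ball \<Omega> p = {\<eta>. \<forall>\<xi>\<in>hilbert_ball \<Omega> p. \<eta> \<bullet> \<xi> \<le> 1}"

definition T0 :: "(real^2) set" where
  "T0 = convex hull {vector [0, 0], vector [0, 2], vector [2, 0]}"

end

theory Submission
  imports Defs
begin

text \<open>
  At \<open>p = (x, y)\<close> in the triangle, with \<open>z = 2 - x - y\<close>, put \<open>a = (-1/x, 0)\<close>, \<open>b = (0, -1/y)\<close> and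
  \<open>c = (1/z, 1/z)\<close>. A ray \<open>p + t \<xi>\<close> leaves the triangle when the largest of the numbers
  \<open>t (a \<bullet> \<xi>)\<close>, \<open>t (b \<bullet> \<xi>)\<close>, \<open>t (c \<bullet> \<xi>)\<close> reaches 1, so the Hilbert norm of \<open>\<xi>\<close> is half the
  difference between the maximum and the minimum of \<open>a \<bullet> \<xi>\<close>, \<open>b \<bullet> \<xi>\<close>, \<open>c \<bullet> \<xi>\<close>. In the coordinates
  \<open>(a - b) \<bullet> \<xi> / 2\<close> and \<open>(b - c) \<bullet> \<xi> / 2\<close> the unit ball is therefore the fixed hexagon
  \<open>|s|, |t|, |s + t| \<le> 1\<close>, whose polar is a hexagon of area 3. The dual ball is the image of that
  polar under the matrix with columns \<open>(a - b)/2\<close> and \<open>(b - c)/2\<close>, of determinant \<open>1/(2xyz)\<close>.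
\<close>

section \<open>The triangle, its interior and its boundary\<close>

lemma inner_vec2: "(v :: real^2) \<bullet> w = v $ 1 * w $ 1 + v $ 2 * w $ 2"
  by (simp add: inner_vec_def sum_2)

lemma vec2_eq_iff: "(v :: 'a^2) = w \<longleftrightarrow> v $ 1 = w $ 1 \<and> v $ 2 = w $ 2"
  by (simp add: vec_eq_iff forall_2)

lemma T0_eq: "T0 = {v. 0 \<le> v $ 1 \<and> 0 \<le> v $ 2 \<and> v $ 1 + v $ 2 \<le> 2}"
proof (intro set_eqI iffI)
  fix v :: "real^2"
  assume "v \<in> T0"
  then show "v \<in> {v. 0 \<le> v $ 1 \<and> 0 \<le> v $ 2 \<and> v $ 1 + v $ 2 \<le> 2}"
    by (auto simp: T0_def convex_hull_3)
next
  fix v :: "real^2"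
  assume "v \<in> {v. 0 \<le> v $ 1 \<and> 0 \<le> v $ 2 \<and> v $ 1 + v $ 2 \<le> 2}"
  then show "v \<in> T0"
    unfolding T0_def convex_hull_3
    \<comment> \<open>Barycentric coordinates of \<open>v\<close> for the three vertices, in the
      order of \<open>T0_def\<close>.\<close>
    by (intro CollectI exI[of _ "1 - v $ 1 / 2 - v $ 2 / 2"] exI[of _ "v $ 2 / 2"] exI[of _ "v $ 1 / 2"])
      (simp add: vec2_eq_iff)
qed

lemma interior_T0: "interior T0 = {v. 0 < v $ 1 \<and> 0 < v $ 2 \<and> v $ 1 + v $ 2 < 2}"
proof -
  let ?h = "\<lambda>a b c. {v :: real^2. vector [a, b] \<bullet> v \<le> c}"
  have ne: "vector [-1, 0] \<noteq> (0 :: real^2)" "vector [0, -1] \<noteq> (0 :: real^2)"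
    "vector [1, 1] \<noteq> (0 :: real^2)"
    by (auto simp: vec2_eq_iff)
  have "T0 = ?h (-1) 0 0 \<inter> ?h 0 (-1) 0 \<inter> ?h 1 1 2"
    by (auto simp: T0_eq inner_vec2)
  then have "interior T0 = interior (?h (-1) 0 0 \<inter> ?h 0 (-1) 0 \<inter> ?h 1 1 2)"
    by (rule arg_cong)
  also have "\<dots> = interior (?h (-1) 0 0) \<inter> interior (?h 0 (-1) 0) \<inter> interior (?h 1 1 2)"
    by (simp only: interior_Int)
  also have "\<dots> = {v. 0 < v $ 1 \<and> 0 < v $ 2 \<and> v $ 1 + v $ 2 < 2}"
    unfolding interior_halfspace_le[OF ne(1)] interior_halfspace_le[OF ne(2)]
      interior_halfspace_le[OF ne(3)]
    by (auto simp: inner_vec2)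
  finally show ?thesis .
qed

lemma frontier_interior_T0: "frontier (interior T0) = T0 - interior T0"
proof -
  have "convex T0" "closed T0"
    by (simp_all add: T0_def compact_imp_closed compact_convex_hull finite_imp_compact)
  \<comment> \<open>A convex set has the same closure as its interior once that interior is
    nonempty; this point is the witness.\<close>
  moreover have "vector [1/2, 1/2] \<in> interior T0"
    by (simp add: interior_T0)
  ultimately have "closure (interior T0) = T0"
    using convex_closure_interior[of T0] by auto
  then show ?thesis
    by (simp add: frontier_def)
qed

section \<open>Minkowski gauge and Hilbert norm\<close>

definition T0_gauge :: "real^2 \<Rightarrow> real^2 \<Rightarrow> real" where
  "T0_gauge p \<xi> = max (max (- \<xi> $ 1 / p $ 1) (- \<xi> $ 2 / p $ 2)) ((\<xi> $ 1 + \<xi> $ 2) / (2 - p $ 1 - p $ 2))"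

text \<open>This is boundedness of the triangle: a direction in which no side is approached has
  nonnegative entries with sum at most 0, hence is 0.\<close>

lemma T0_gauge_pos:
  assumes "p \<in> interior T0" "\<xi> \<noteq> 0"
  shows "T0_gauge p \<xi> > 0"
proof (rule ccontr)
  assume "\<not> T0_gauge p \<xi> > 0"
  then have "- \<xi> $ 1 / p $ 1 \<le> 0" "- \<xi> $ 2 / p $ 2 \<le> 0" "(\<xi> $ 1 + \<xi> $ 2) / (2 - p $ 1 - p $ 2) \<le> 0"
    unfolding T0_gauge_def by linarith+
  moreover have "p $ 1 > 0" "p $ 2 > 0" "2 - p $ 1 - p $ 2 > 0"
    using assms(1) by (auto simp: interior_T0)
  ultimately have "\<xi> $ 1 \<ge> 0" "\<xi> $ 2 \<ge> 0" "\<xi> $ 1 + \<xi> $ 2 \<le> 0"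
    by (simp_all add: divide_le_0_iff zero_le_divide_iff)
  with assms(2) show False
    by (simp add: vec2_eq_iff)
qed

text \<open>\<open>T0_gauge p\<close> is the Minkowski functional of the triangle recentred at
  \<open>p\<close>: dividing each side inequality at \<open>p + t *\<^sub>R \<xi>\<close> by its
  positive slack at \<open>p\<close> bounds one term of the maximum by \<open>1 / t\<close>.\<close>

lemma ray_in_T0_iff:
  assumes "p \<in> interior T0" "t > 0"
  shows "p + t *\<^sub>R \<xi> \<in> T0 \<longleftrightarrow> t * T0_gauge p \<xi> \<le> 1"
    and "p + t *\<^sub>R \<xi> \<in> interior T0 \<longleftrightarrow> t * T0_gauge p \<xi> < 1"
proof -
  have p: "p $ 1 > 0" "p $ 2 > 0" "2 - p $ 1 - p $ 2 > 0"
    using assms(1) by (auto simp: interior_T0)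
  have max: "t * T0_gauge p \<xi> = max (max (t * (- \<xi> $ 1 / p $ 1)) (t * (- \<xi> $ 2 / p $ 2)))
      (t * ((\<xi> $ 1 + \<xi> $ 2) / (2 - p $ 1 - p $ 2)))"
    using assms(2) by (simp add: T0_gauge_def max_mult_distrib_left)
  show "p + t *\<^sub>R \<xi> \<in> T0 \<longleftrightarrow> t * T0_gauge p \<xi> \<le> 1"
    unfolding max max.bounded_iff using p by (auto simp: T0_eq field_simps)
  show "p + t *\<^sub>R \<xi> \<in> interior T0 \<longleftrightarrow> t * T0_gauge p \<xi> < 1"
    unfolding max max_less_iff_conj using p by (auto simp: interior_T0 field_simps)
qed

lemma forward_point_T0:
  assumes "p \<in> interior T0" "\<xi> \<noteq> 0"
  shows "forward_point (interior T0) p \<xi> = p + (1 / T0_gauge p \<xi>) *\<^sub>R \<xi>"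
proof -
  have pos: "T0_gauge p \<xi> > 0"
    using T0_gauge_pos assms by blast
  have on_frontier: "p + t *\<^sub>R \<xi> \<in> frontier (interior T0) \<longleftrightarrow> t = 1 / T0_gauge p \<xi>" if "t > 0" for t
    unfolding frontier_interior_T0 using ray_in_T0_iff[OF assms(1) that, of \<xi>] pos
    by (auto simp: field_simps)
  show ?thesis
    unfolding forward_point_def
  proof (rule the_equality)
    show "p + (1 / T0_gauge p \<xi>) *\<^sub>R \<xi> \<in> frontier (interior T0) \<and>
        (\<exists>t>0. p + (1 / T0_gauge p \<xi>) *\<^sub>R \<xi> = p + t *\<^sub>R \<xi>)"
      using on_frontier pos by (metis zero_less_divide_1_iff)
  qed (use on_frontier in auto)
qed

lemma sigma_plus_T0:
  assumes "p \<in> interior T0" "\<xi> \<noteq> 0"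
  shows "sigma_plus (interior T0) p \<xi> = T0_gauge p \<xi>"
  unfolding sigma_plus_def forward_point_T0[OF assms]
proof (rule the_equality)
  show "T0_gauge p \<xi> > 0 \<and> \<xi> = T0_gauge p \<xi> *\<^sub>R (p + (1 / T0_gauge p \<xi>) *\<^sub>R \<xi> - p)"
    using T0_gauge_pos[OF assms] by simp
next
  fix s
  assume "s > 0 \<and> \<xi> = s *\<^sub>R (p + (1 / T0_gauge p \<xi>) *\<^sub>R \<xi> - p)"
  then have "1 *\<^sub>R \<xi> = (s / T0_gauge p \<xi>) *\<^sub>R \<xi>"
    by simp
  then have "s / T0_gauge p \<xi> = 1"
    using assms(2) by (metis scaleR_right_imp_eq)
  then show "s = T0_gauge p \<xi>"
    by (simp add: divide_eq_1_iff)
qed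

text \<open>Reversing the direction exchanges the two boundary points, so the forward computation
  also covers the backward one.\<close>

lemma sigma_minus_conv_sigma_plus: "sigma_minus \<Omega> p \<xi> = sigma_plus \<Omega> p (- \<xi>)"
proof -
  have "\<xi> = s *\<^sub>R (p - q) \<longleftrightarrow> - \<xi> = s *\<^sub>R (q - p)" for s q
    by (metis minus_diff_eq minus_equation_iff scaleR_minus_right)
  moreover have "backward_point \<Omega> p \<xi> = forward_point \<Omega> p (- \<xi>)"
    by (simp add: backward_point_def forward_point_def)
  ultimately show ?thesis
    by (simp add: sigma_minus_def sigma_plus_def)
qed

lemma hilbert_norm_T0:
  assumes "p \<in> interior T0"
  shows "hilbert_norm (interior T0) p \<xi> = (T0_gauge p \<xi> + T0_gauge p (- \<xi>)) / 2"
proof (cases "\<xi> = 0")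
  case True
  then show ?thesis
    by (simp add: hilbert_norm_def T0_gauge_def)
next
  case False
  then show ?thesis
    using assms by (simp add: hilbert_norm_def sigma_minus_conv_sigma_plus sigma_plus_T0)
qed

section \<open>Linear coordinates, hexagons and polarity\<close>

definition dual_frame :: "real^2 \<Rightarrow> real^2^2" where
  "dual_frame p =
    vector [vector [- 1 / (2 * p $ 1), - 1 / (2 * (2 - p $ 1 - p $ 2))],
            vector [1 / (2 * p $ 2), - 1 / (2 * p $ 2) - 1 / (2 * (2 - p $ 1 - p $ 2))]]"

lemma det_dual_frame:
  assumes "p \<in> interior T0"
  shows "det (dual_frame p) = 1 / (2 * p $ 1 * p $ 2 * (2 - p $ 1 - p $ 2))"
proof -
  define z where "z = 2 - p $ 1 - p $ 2"
  have p: "p $ 1 > 0" "p $ 2 > 0" "z > 0"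
    using assms by (auto simp: interior_T0 z_def)
  have "det (dual_frame p) = (p $ 1 + p $ 2 + z) / (4 * p $ 1 * p $ 2 * z)"
    unfolding dual_frame_def det_2 vector_2 z_def[symmetric] using p by (simp add: field_simps)
  \<comment> \<open>The numerator is 2 by the choice of \<open>z\<close>.\<close>
  also have "\<dots> = 1 / (2 * p $ 1 * p $ 2 * z)"
    by (simp add: z_def)
  finally show ?thesis
    by (simp add: z_def)
qed

definition hexagon :: "(real^2) set" where
  "hexagon = {v. \<bar>v $ 1\<bar> \<le> 1 \<and> \<bar>v $ 2\<bar> \<le> 1 \<and> \<bar>v $ 1 + v $ 2\<bar> \<le> 1}"

definition polar_hexagon :: "(real^2) set" where
  "polar_hexagon = {v. \<bar>v $ 1\<bar> \<le> 1 \<and> \<bar>v $ 2\<bar> \<le> 1 \<and> \<bar>v $ 1 - v $ 2\<bar> \<le> 1}"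

text \<open>The gauge at \<open>- \<xi>\<close> is minus the minimum of the three terms, so the norm
  is half their spread. It is at most 1 iff all pairwise differences are at most 2, and
  \<open>a - c\<close> is the sum of the other two.\<close>

lemma hilbert_ball_T0:
  assumes "p \<in> interior T0"
  shows "hilbert_ball (interior T0) p = {\<xi>. \<xi> v* dual_frame p \<in> hexagon}"
proof -
  have "hilbert_norm (interior T0) p \<xi> \<le> 1 \<longleftrightarrow> \<xi> v* dual_frame p \<in> hexagon" for \<xi>
  proof -
    define z where "z = 2 - p $ 1 - p $ 2"
    have p: "p $ 1 > 0" "p $ 2 > 0" "z > 0"
      using assms by (auto simp: interior_T0 z_def)
    define a where "a = - \<xi> $ 1 / p $ 1"
    define b where "b = - \<xi> $ 2 / p $ 2"
    define c where "c = (\<xi> $ 1 + \<xi> $ 2) / z"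
    have "T0_gauge p \<xi> = max (max a b) c" "T0_gauge p (- \<xi>) = max (max (- a) (- b)) (- c)"
      by (simp_all add: T0_gauge_def a_def b_def c_def z_def add_divide_distrib diff_divide_distrib)
    then have "hilbert_norm (interior T0) p \<xi> \<le> 1
        \<longleftrightarrow> \<bar>a - b\<bar> \<le> 2 \<and> \<bar>b - c\<bar> \<le> 2 \<and> \<bar>a - c\<bar> \<le> 2"
      unfolding hilbert_norm_T0[OF assms] by (simp add: max_def abs_le_iff) linarith
    moreover have "(\<xi> v* dual_frame p) $ 1 = (a - b) / 2" "(\<xi> v* dual_frame p) $ 2 = (b - c) / 2"
      unfolding dual_frame_def z_def[symmetric] a_def b_def c_def using p
      by (simp_all add: vector_matrix_mult_def sum_2 field_simps)
    ultimately show ?thesis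
      by (auto simp: hexagon_def)
  qed
  then show ?thesis
    by (simp add: hilbert_ball_def)
qed

lemma polar_of_hexagon: "{v. \<forall>h\<in>hexagon. v \<bullet> h \<le> 1} = polar_hexagon"
proof (intro set_eqI iffI)
  fix v :: "real^2"
  assume "v \<in> {v. \<forall>h\<in>hexagon. v \<bullet> h \<le> 1}"
  then have v: "v \<bullet> h \<le> 1" if "h \<in> hexagon" for h
    using that by blast
  show "v \<in> polar_hexagon"
    \<comment> \<open>Testing the six vertices of \<open>hexagon\<close> yields the six
      inequalities.\<close>
    using v[of "vector [1, 0]"] v[of "vector [-1, 0]"] v[of "vector [0, 1]"] v[of "vector [0, -1]"]
      v[of "vector [1, -1]"] v[of "vector [-1, 1]"]
    by (simp add: hexagon_def polar_hexagon_def inner_vec2 abs_le_iff)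
next
  \<comment> \<open>The form is also \<open>\<alpha> * (s + t) + (\<beta> - \<alpha>) * t\<close>
    and \<open>\<beta> * (s + t) + (\<alpha> - \<beta>) * s\<close>, giving three bounds. As
    \<open>s\<close>, \<open>t\<close>, \<open>- (s + t)\<close> sum to 0, the largest absolute
    value among them is the sum of the other two, so one bound is at most 1.\<close>
  have ineq: "\<alpha> * s + \<beta> * t \<le> 1"
    if "\<bar>\<alpha>\<bar> \<le> 1" "\<bar>\<beta>\<bar> \<le> 1" "\<bar>\<alpha> - \<beta>\<bar> \<le> 1" "\<bar>s\<bar> \<le> 1" "\<bar>t\<bar> \<le> 1" "\<bar>s + t\<bar> \<le> 1"
    for \<alpha> \<beta> s t :: real
  proof -
    have bound: "c * r \<le> \<bar>r\<bar>" if "\<bar>c\<bar> \<le> 1" for c r :: real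
      using mult_right_mono[OF that, of "\<bar>r\<bar>"] abs_ge_self[of "c * r"] by (simp add: abs_mult)
    have "\<alpha> * s + \<beta> * t \<le> \<bar>s\<bar> + \<bar>t\<bar>"
      using bound[of \<alpha> s] bound[of \<beta> t] that by linarith
    moreover have "\<alpha> * s + \<beta> * t \<le> \<bar>s + t\<bar> + \<bar>t\<bar>"
      using bound[OF that(1), of "s + t"] bound[of "\<beta> - \<alpha>" t] that(3)
      by (simp add: abs_minus_commute algebra_simps)
    moreover have "\<alpha> * s + \<beta> * t \<le> \<bar>s\<bar> + \<bar>s + t\<bar>"
      using bound[OF that(2), of "s + t"] bound[OF that(3), of s] by (simp add: algebra_simps)
    ultimately show ?thesis
      using that(4-6) by linarith
  qed
  fix v :: "real^2"
  assume "v \<in> polar_hexagon"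
  then show "v \<in> {v. \<forall>h\<in>hexagon. v \<bullet> h \<le> 1}"
    by (auto simp: hexagon_def polar_hexagon_def inner_vec2 intro!: ineq)
qed

lemma polar_vector_matrix_preimage:
  fixes A :: "real^'n^'n"
  assumes "invertible A"
  shows "{\<eta>. \<forall>\<xi>\<in>{\<xi>. \<xi> v* A \<in> H}. \<eta> \<bullet> \<xi> \<le> 1} = (*v) A ` {v. \<forall>h\<in>H. v \<bullet> h \<le> 1}"
proof -
  obtain B where B: "A ** B = mat 1" "B ** A = mat 1"
    using assms unfolding invertible_def by blast
  have inner: "(A *v v) \<bullet> \<xi> = v \<bullet> (\<xi> v* A)" for v \<xi>
    by (metis dot_lmul_matrix inner_commute)
  have surj_v: "(A *v (B *v \<eta>)) = \<eta>" for \<eta>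
    by (simp add: matrix_vector_mul_assoc B)
  have surj_h: "(h v* B) v* A = h" for h
    by (simp add: vector_matrix_mul_assoc B)
  show ?thesis
  proof (intro set_eqI iffI)
    fix \<eta>
    assume \<eta>: "\<eta> \<in> {\<eta>. \<forall>\<xi>\<in>{\<xi>. \<xi> v* A \<in> H}. \<eta> \<bullet> \<xi> \<le> 1}"
    have "(B *v \<eta>) \<bullet> h \<le> 1" if "h \<in> H" for h
    proof -
      have "h v* B \<in> {\<xi>. \<xi> v* A \<in> H}"
        using that by (simp add: surj_h)
      with \<eta> have "\<eta> \<bullet> (h v* B) \<le> 1"
        by blast
      then show ?thesis
        by (metis dot_lmul_matrix inner_commute)
    qed
    then show "\<eta> \<in> (*v) A ` {v. \<forall>h\<in>H. v \<bullet> h \<le> 1}"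
      by (intro image_eqI[where x = "B *v \<eta>"]) (simp_all add: surj_v)
  qed (auto simp: inner)
qed

section \<open>Area of the polar hexagon\<close>

lemma polar_hexagon_lmeasurable: "polar_hexagon \<in> lmeasurable"
  and measure_polar_hexagon: "measure lebesgue polar_hexagon = 3"
proof -
  let ?Q = "cbox (vector [-1, -1]) (vector [1, 1]) :: (real^2) set"
  let ?U = "convex hull {vector [-1, 0], vector [0, 1], vector [-1, 1]} :: (real^2) set"
  let ?L = "convex hull {vector [0, -1], vector [1, 0], vector [1, -1]} :: (real^2) set"
  have Q: "?Q = {v. \<bar>v $ 1\<bar> \<le> 1 \<and> \<bar>v $ 2\<bar> \<le> 1}"
    by (auto simp: mem_box_cart forall_2)
  have U: "?U = {v. -1 \<le> v $ 1 \<and> v $ 2 \<le> 1 \<and> 1 \<le> v $ 2 - v $ 1}" (is "_ = ?U'")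
  proof (intro set_eqI iffI)
    show "v \<in> ?U" if "v \<in> ?U'" for v
      using that unfolding convex_hull_3
      by (intro CollectI exI[of _ "1 - v $ 2"] exI[of _ "v $ 1 + 1"] exI[of _ "v $ 2 - v $ 1 - 1"])
        (simp add: vec2_eq_iff)
  qed (auto simp: convex_hull_3)
  have L: "?L = {v. -1 \<le> v $ 2 \<and> v $ 1 \<le> 1 \<and> 1 \<le> v $ 1 - v $ 2}" (is "_ = ?L'")
  proof (intro set_eqI iffI)
    show "v \<in> ?L" if "v \<in> ?L'" for v
      using that unfolding convex_hull_3
      by (intro CollectI exI[of _ "1 - v $ 1"] exI[of _ "v $ 2 + 1"] exI[of _ "v $ 1 - v $ 2 - 1"])
        (simp add: vec2_eq_iff)
  qed (auto simp: convex_hull_3)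
  have compact_UL: "compact ?U" "compact ?L"
    by (simp_all add: compact_convex_hull finite_imp_compact)
  have "polar_hexagon = ?Q \<inter> {v. vector [1, -1] \<bullet> v \<le> 1} \<inter> {v. vector [-1, 1] \<bullet> v \<le> 1}"
    unfolding Q by (auto simp: polar_hexagon_def inner_vec2 abs_le_iff)
  then have "compact polar_hexagon"
    by (metis compact_Int_closed compact_cbox closed_halfspace_le)
  then show meas: "polar_hexagon \<in> lmeasurable"
    by (rule lmeasurable_compact)
  \<comment> \<open>The hexagon meets \<open>?U\<close> inside the line with \<open>c = -1\<close>
    and \<open>?L\<close> inside the one with \<open>c = 1\<close>; the two triangles are
    disjoint.\<close>
  have line: "negligible {v :: real^2. vector [1, -1] \<bullet> v = c}" for c
    by (rule negligible_hyperplane) (simp add: vec2_eq_iff)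
  \<comment> \<open>The hexagon is the square of area 4 with two opposite corner triangles of area
    1/2 cut off.\<close>
  have "measure lebesgue ?Q = measure lebesgue polar_hexagon + measure lebesgue ?U + measure lebesgue ?L"
  proof (rule measure_Un3_negligible)
    show "negligible (polar_hexagon \<inter> ?U)" "negligible (polar_hexagon \<inter> ?L)" "negligible (?U \<inter> ?L)"
      unfolding U L polar_hexagon_def
      by (rule negligible_subset[OF line[of "-1"]], force simp: inner_vec2 abs_le_iff)
        (rule negligible_subset[OF line[of 1]], force simp: inner_vec2 abs_le_iff)+
    show "polar_hexagon \<union> ?U \<union> ?L = ?Q"
      unfolding U L Q polar_hexagon_def by auto
  qed (use meas compact_UL in \<open>auto intro: lmeasurable_compact\<close>)
  moreover have "measure lebesgue ?Q = 4"
  proof -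
    have "?Q \<noteq> {}"
      by (auto simp: Q intro!: exI[of _ 0])
    then show ?thesis
      by (simp add: content_cbox_cart UNIV_2)
  qed
  moreover have "measure lebesgue ?U = 1 / 2" "measure lebesgue ?L = 1 / 2"
    using compact_UL by (simp_all add: content_triangle measure_completion compact_imp_closed)
  ultimately show "measure lebesgue polar_hexagon = 3"
    by simp
qed

theorem proposition1p6:
  fixes x y :: real
  assumes "vector [x, y] \<in> interior T0"
  shows "measure lebesgue (dual_hilbert_ball (interior T0) (vector [x, y]))
           = 3 / (2 * x * y * (2 - x - y))"
proof -
  let ?A = "dual_frame (vector [x, y])"
  have pos: "x > 0" "y > 0" "2 - x - y > 0"
    using assms by (auto simp: interior_T0)
  have det: "det ?A = 1 / (2 * x * y * (2 - x - y))"
    using det_dual_frame[OF assms] by simp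
  have "det ?A > 0"
    unfolding det using pos by simp
  then have "dual_hilbert_ball (interior T0) (vector [x, y]) = (*v) ?A ` polar_hexagon"
    unfolding dual_hilbert_ball_def hilbert_ball_T0[OF assms] polar_of_hexagon[symmetric]
    by (intro polar_vector_matrix_preimage) (simp add: invertible_det_nz)
  then have "measure lebesgue (dual_hilbert_ball (interior T0) (vector [x, y])) = \<bar>det ?A\<bar> * 3"
    by (simp add: measure_linear_image polar_hexagon_lmeasurable measure_polar_hexagon)
  also have "\<dots> = 3 / (2 * x * y * (2 - x - y))"
    using \<open>det ?A > 0\<close> by (simp add: det)
  finally show ?thesis .
qed

end
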